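(* Let $m,n\ge1$ be integers with $(m,n)\neq(1,1)$, and let $\mathfrak{g}=\mathfrak{g}_{\bar 0}\oplus\mathfrak{g}_{\bar 1}=\mathfrak{sl}(m|n)$. Let $\lambda=(\lambda_1,\dots,\lambda_{r+s})$, $\lambda_1\ge\dots\ge\lambda_{r+s}$, be a partition of $(m|n)$, let $e\in\mathfrak{g}_{\bar 0}$ be the nilpotent element determined by the Dynkin pyramid of $\lambda$, and let $l=\lambda_1-1$. Then $\mathfrak{z}(\mathfrak{g}^{e})=\langle e,e^2,\dots,e^{l}\rangle$, except when $m=n$, $n>1$, in which case $\mathfrak{z}(\mathfrak{g}^{e})=\langle I,e,\dots,e^{l}\rangle$.
   Context: Everything is over $\mathbb C$. $\mathfrak{sl}(m|n)$ is the Lie superalgebra of supertraceless endomorphisms of a superspace $V=V_{\bar 0}\oplus V_{\bar 1}$ with $\dim V_{\bar 0}=m$, $\dim V_{\bar 1}=n$; $I$ is the identity of $V$, and powers $e^k$ are taken in $\mathrm{End}(V)$. $\langle\cdots\rangle$ denotes linear span. $\mathfrak g^e=\{x\in\mathfrak g:[e,x]=0\}$ and $\mathfrak z(\mathfrak g^e)=\{x\in\mathfrak g^e:[x,y]=0\ \forall y\in\mathfrak g^e\}$ (supercommutator). A partition of $(m|n)$ is a pair $(p|q)$ with $p$ a partition of $m$ and $q$ a partition of $n$; the sequence $\lambda_1\ge\dots\ge\lambda_{r+s}$ lists all parts of $p$ and $q$ together in weakly decreasing order (for equal parts, those of $p$ first), and $|i|=\bar 0$ or $\bar 1$ according to whether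 $\lambda_i$ comes from $p$ or $q$. The Dynkin pyramid of $\lambda$ consists of boxes arranged in rows $1,\dots,r+s$ from bottom to top, row $j$ having $\lambda_j$ boxes of parity $|j|$ in columns $1-\lambda_j,3-\lambda_j,\dots,\lambda_j-1$. The boxes are numbered $1,\dots,m+n$ and index a homogeneous basis $v_1,\dots,v_{m+n}$ of $V$, $v_i$ having the parity of the row of box $i$; the nilpotent element $e$ determined by the pyramid sends $v_i$ to $v_j$ if box $j$ is the left neighbour of box $i$ in the same row, and $v_i$ to $0$ if box $i$ has no left neighbour. Thus $e$ has Jordan type $p$ on $V_{\bar 0}$ and $q$ on $V_{\bar 1}$. *)

theory Defs
  imports Complex_Main "Jordan_Normal_Form.VS_Connect"
begin

section \<open>The Lie superalgebra of supertraceless matrices\<close>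

text \<open>
  Elements of \<open>\<int>/2\<close> are Booleans, \<open>True\<close> being odd.  A superspace of dimension \<open>N\<close> with a chosen
  homogeneous basis is given by the function \<open>par\<close> assigning to each index \<open>i < N\<close> the parity of
  the \<open>i\<close>-th basis vector; endomorphisms are written as matrices in that basis, column \<open>j\<close> being the
  image of the \<open>j\<close>-th basis vector.
\<close>

definition hom_part :: "(nat \<Rightarrow> bool) \<Rightarrow> bool \<Rightarrow> complex mat \<Rightarrow> complex mat" where
  "hom_part par d x =
     mat (dim_row x) (dim_col x) (\<lambda>(i, j). if (par i \<noteq> par j) = d then x $$ (i, j) else 0)"

text \<open>The bilinear extension of \<open>[x, y] = x y - (-1)\<^bsup>|x||y|\<^esup> y x\<close> from homogeneous \<open>x\<close>, \<open>y\<close>.\<close>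

definition super_comm :: "(nat \<Rightarrow> bool) \<Rightarrow> complex mat \<Rightarrow> complex mat \<Rightarrow> complex mat" where
  "super_comm par x y =
     (let x0 = hom_part par False x; x1 = hom_part par True x;
          y0 = hom_part par False y; y1 = hom_part par True y
      in (x0 * y0 - y0 * x0) + (x0 * y1 - y1 * x0) + (x1 * y0 - y0 * x1) + (x1 * y1 + y1 * x1))"

definition supertrace :: "(nat \<Rightarrow> bool) \<Rightarrow> complex mat \<Rightarrow> complex" where
  "supertrace par x = (\<Sum>i<dim_row x. (if par i then - 1 else 1) * x $$ (i, i))"

definition special_linear :: "nat \<Rightarrow> (nat \<Rightarrow> bool) \<Rightarrow> complex mat set" where
  "special_linear N par = {x \<in> carrier_mat N N. supertrace par x = 0}"

definition super_centralizer ::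
    "nat \<Rightarrow> (nat \<Rightarrow> bool) \<Rightarrow> complex mat set \<Rightarrow> complex mat \<Rightarrow> complex mat set" where
  "super_centralizer N par \<gg> e = {x \<in> \<gg>. super_comm par e x = 0\<^sub>m N N}"

definition super_center :: "nat \<Rightarrow> (nat \<Rightarrow> bool) \<Rightarrow> complex mat set \<Rightarrow> complex mat set" where
  "super_center N par \<hh> = {x \<in> \<hh>. \<forall>y\<in>\<hh>. super_comm par x y = 0\<^sub>m N N}"

definition mat_span :: "nat \<Rightarrow> complex mat set \<Rightarrow> complex mat set" where
  "mat_span N = LinearCombinations.module.span class_ring (module_mat TYPE(complex) N N)"


section \<open>Partitions and Dynkin pyramids\<close>

definition is_partition :: "nat list \<Rightarrow> nat \<Rightarrow> bool" where
  "is_partition p k \<longleftrightarrow> sorted_wrt (\<ge>) p \<and> (\<forall>a\<in>set p. 0 < a) \<and> sum_list p = k"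

text \<open>
  All parts of \<open>p\<close> and \<open>q\<close> with their parities.  As \<^const>\<open>sort_key\<close> is stable, parts of \<open>p\<close>
  precede equal parts of \<open>q\<close>.
\<close>

definition super_parts :: "nat list \<Rightarrow> nat list \<Rightarrow> (nat \<times> bool) list" where
  "super_parts p q =
     sort_key (\<lambda>(a, _). - int a) (map (\<lambda>a. (a, False)) p @ map (\<lambda>a. (a, True)) q)"

text \<open>Rows are numbered from 1.\<close>

definition part :: "nat list \<Rightarrow> nat list \<Rightarrow> nat \<Rightarrow> nat" where
  "part p q j = fst (super_parts p q ! (j - 1))"

definition part_parity :: "nat list \<Rightarrow> nat list \<Rightarrow> nat \<Rightarrow> bool" where
  "part_parity p q j = snd (super_parts p q ! (j - 1))"

text \<open>A box is the pair of its row and its column.\<close>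

definition pyramid :: "nat list \<Rightarrow> nat list \<Rightarrow> (nat \<times> int) set" where
  "pyramid p q = {(j, 1 - int (part p q j) + 2 * int k) | j k.
                    1 \<le> j \<and> j \<le> length p + length q \<and> k < part p q j}"

text \<open>
  A numbering of the boxes is a bijection \<open>bx\<close> from the matrix indices \<open>0, \<dots>, N - 1\<close> onto the
  pyramid.
\<close>

definition box_parity :: "nat list \<Rightarrow> nat list \<Rightarrow> (nat \<Rightarrow> nat \<times> int) \<Rightarrow> nat \<Rightarrow> bool" where
  "box_parity p q bx i = part_parity p q (fst (bx i))"

definition left_neighbour :: "nat \<times> int \<Rightarrow> nat \<times> int" where
  "left_neighbour b = (fst b, snd b - 2)"

definition pyramid_nilpotent :: "nat \<Rightarrow> (nat \<Rightarrow> nat \<times> int) \<Rightarrow> complex mat" where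
  "pyramid_nilpotent N bx = mat N N (\<lambda>(j, i). if bx j = left_neighbour (bx i) then 1 else 0)"


section \<open>Consistency of the conventions\<close>

lemma super_comm_homogeneous:
  assumes x: "x \<in> carrier_mat N N" and y: "y \<in> carrier_mat N N"
    and hx: "hom_part par a x = x" and hy: "hom_part par b y = y"
  shows "super_comm par x y = x * y - (if a \<and> b then - 1 else 1) \<cdot>\<^sub>m (y * x)"
proof -
  have zero: "hom_part par (\<not> d) z = 0\<^sub>m N N"
    if z: "z \<in> carrier_mat N N" and h: "hom_part par d z = z" for z d
  proof (rule eq_matI)
    fix i j assume ij: "i < dim_row (0\<^sub>m N N :: complex mat)" "j < dim_col (0\<^sub>m N N :: complex mat)"
    have "z $$ (i, j) = hom_part par d z $$ (i, j)" using h by simp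
    then show "hom_part par (\<not> d) z $$ (i, j) = 0\<^sub>m N N $$ (i, j)"
      using z ij by (auto simp: hom_part_def split: if_splits)
  qed (use z in \<open>auto simp: hom_part_def\<close>)
  note zx = zero[OF x hx] and zy = zero[OF y hy]
  have prods: "x * y \<in> carrier_mat N N" "y * x \<in> carrier_mat N N" using x y by auto
  show ?thesis
    using hx hy zx zy x y prods
    by (cases a; cases b) (auto simp: super_comm_def Let_def intro!: eq_matI)
qed

lemma super_parts_mset:
  "mset (super_parts p q) = mset (map (\<lambda>a. (a, False)) p) + mset (map (\<lambda>a. (a, True)) q)"
  by (simp add: super_parts_def)

lemma length_super_parts: "length (super_parts p q) = length p + length q"
  by (simp add: super_parts_def)

lemma card_boxes:
  "card {b \<in> pyramid p q. part_parity p q (fst b) = d} = sum_list (if d then q else p)"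
proof -
  let ?L = "super_parts p q"
  let ?J = "{i \<in> {..<length ?L}. snd (?L ! i) = d}"
  let ?f = "\<lambda>(i, k). (Suc i, 1 - int (fst (?L ! i)) + 2 * int k)"
  let ?S = "SIGMA i:?J. {..<fst (?L ! i)}"
  have "{b \<in> pyramid p q. part_parity p q (fst b) = d} = ?f ` ?S" (is "?A = ?B")
  proof
    show "?A \<subseteq> ?B"
    proof
      fix b assume "b \<in> ?A"
      then obtain j k where "b = (j, 1 - int (part p q j) + 2 * int k)" "1 \<le> j"
          "j \<le> length p + length q" "k < part p q j" "part_parity p q j = d"
        by (auto simp: pyramid_def)
      then show "b \<in> ?B"
        by (intro image_eqI[of _ _ "(j - 1, k)"])
          (auto simp: part_def part_parity_def length_super_parts)
    qed
    show "?B \<subseteq> ?A"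
      by (fastforce simp: pyramid_def part_def part_parity_def length_super_parts)
  qed
  moreover have "inj_on ?f ?S" by (auto simp: inj_on_def)
  ultimately have "card ?A = card ?S" by (simp add: card_image)
  also have "\<dots> = (\<Sum>i\<in>?J. fst (?L ! i))" by simp
  also have "\<dots> = (\<Sum>i<length ?L. if snd (?L ! i) = d then fst (?L ! i) else 0)"
    by (rule sum.inter_filter[OF finite_lessThan])
  also have "\<dots> = sum_list (map (\<lambda>x. if snd x = d then fst x else 0) ?L)"
    by (simp add: sum_list_sum_nth atLeast0LessThan)
  also have "\<dots> = sum_list (map (\<lambda>x. if snd x = d then fst x else 0)
                       (map (\<lambda>a. (a, False)) p @ map (\<lambda>a. (a, True)) q))"
    by (simp only: sum_mset_sum_list[symmetric] mset_map mset_append super_parts_mset)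
  also have "\<dots> = sum_list (if d then q else p)"
    by (cases d) (simp_all add: o_def)
  finally show ?thesis .
qed

text \<open>Hence \<^const>\<open>special_linear\<close> for these parities is \<open>sl(m|n)\<close>.\<close>

lemma card_indices_of_parity:
  assumes "is_partition p m" and "is_partition q n"
    and bx: "bij_betw bx {..<m + n} (pyramid p q)"
  shows "card {i. i < m + n \<and> box_parity p q bx i = d} = (if d then n else m)"
proof -
  let ?I = "{i. i < m + n \<and> box_parity p q bx i = d}"
  have "bx ` ?I = {b \<in> bx ` {..<m + n}. part_parity p q (fst b) = d}"
    unfolding box_parity_def by blast
  then have "bx ` ?I = {b \<in> pyramid p q. part_parity p q (fst b) = d}"
    using bx by (simp add: bij_betw_def)
  moreover have "inj_on bx ?I"
    using bx by (auto simp: bij_betw_def intro: inj_on_subset)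
  ultimately have "card ?I = sum_list (if d then q else p)"
    using card_boxes[of p q d] card_image[of bx ?I] by simp
  then show ?thesis using assms by (simp add: is_partition_def)
qed

lemma pyramid_nilpotent_even:
  "hom_part (box_parity p q bx) False (pyramid_nilpotent N bx) = pyramid_nilpotent N bx"
  by (rule eq_matI)
    (auto simp: hom_part_def pyramid_nilpotent_def box_parity_def left_neighbour_def)

lemma pyramid_nilpotent_in_special_linear:
  "pyramid_nilpotent N bx \<in> special_linear N par"
proof -
  have "bx i \<noteq> left_neighbour (bx i)" for i
    by (metis left_neighbour_def snd_conv diff_eq_eq add_0_iff zero_neq_numeral add.commute)
  then show ?thesis
    by (auto simp: special_linear_def supertrace_def pyramid_nilpotent_def intro!: sum.neutral)
qed

end

theory Submission
  imports Defs
begin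

text \<open>
  Let \<open>t\<close> act on \<open>V\<close> by \<open>e\<close>.  Then \<open>V\<close> is the direct sum of the cyclic modules
  \<open>V\<^sub>j = \<complex>[t]/(t^\<lambda>\<^sub>j)\<close>, one for each row of the pyramid, and the centralizer of \<open>e\<close> in \<open>gl(m|n)\<close> is the
  algebra of \<open>\<complex>[t]\<close>-linear endomorphisms.  For rows \<open>k \<noteq> l\<close> there is a distinguished map
  \<open>y\<^bsub>kl\<^esub> : V\<^sub>l \<rightarrow> V\<^sub>k\<close> (lemma \<open>transfer_in_centralizer\<close>): the quotient map if \<open>\<lambda>\<^sub>l \<ge> \<lambda>\<^sub>k\<close> and the
  inclusion if \<open>\<lambda>\<^sub>l \<le> \<lambda>\<^sub>k\<close>.  Extended by zero to \<open>V\<close> it has zero diagonal, hence zero supertrace, and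
  lies in \<open>\<gg>\<^sup>e\<close>.

  These maps already determine the centre.  Let \<open>x\<close> supercommute with all of them, with blocks
  \<open>x\<^bsub>ij\<^esub> : V\<^sub>j \<rightarrow> V\<^sub>i\<close>.  For \<open>i \<noteq> k\<close>, the blocks of \<open>[x, y\<^bsub>ki\<^esub>] = 0\<close> at \<open>(i, i)\<close> and \<open>(k, k)\<close> read,
  up to sign, \<open>x\<^bsub>ik\<^esub> y\<^bsub>ki\<^esub> = 0\<close> and \<open>y\<^bsub>ki\<^esub> x\<^bsub>ik\<^esub> = 0\<close>.  As \<open>y\<^bsub>ki\<^esub>\<close> is surjective or injective, one of the two gives
  \<open>x\<^bsub>ik\<^esub> = 0\<close> (lemma \<open>off_diagonal_block_zero\<close>).  Now take \<open>l\<close> a longest row.  The block of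
  \<open>[x, y\<^bsub>kl\<^esub>] = 0\<close> at \<open>(k, l)\<close> is \<open>x\<^bsub>kk\<^esub> y\<^bsub>kl\<^esub> = y\<^bsub>kl\<^esub> x\<^bsub>ll\<^esub>\<close>, without a sign because diagonal blocks are even,
  and \<open>y\<^bsub>kl\<^esub>\<close> is a quotient map, so \<open>x\<^bsub>kk\<^esub>\<close> is induced by \<open>x\<^bsub>ll\<^esub>\<close> (lemma \<open>diagonal_block_from_longest\<close>).
  Finally \<open>x\<^bsub>ll\<^esub>\<close> is \<open>\<complex>[t]\<close>-linear on a cyclic module, hence multiplication by a polynomial \<open>f\<close>, and
  therefore \<open>x = f(e)\<close> (lemma \<open>center_is_polynomial\<close>).

  Conversely every polynomial in \<open>e\<close> is even and commutes with all of \<open>\<gg>\<^sup>e\<close>, so it is central as soon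
  as it is supertraceless.  The supertrace of \<open>f(e)\<close> is \<open>f(0) (m - n)\<close>, as the positive powers of
  \<open>e\<close> have zero diagonal; hence the constant term is free if \<open>m = n\<close> and must vanish otherwise.
\<close>

section \<open>The supercommutator and spans of matrices, entrywise\<close>

lemma super_comm_index:
  assumes x: "x \<in> carrier_mat N N" and y: "y \<in> carrier_mat N N" and a: "a < N" and b: "b < N"
  shows "super_comm par x y $$ (a, b) =
    (\<Sum>c<N. x $$ (a, c) * y $$ (c, b)
       - (if par a \<noteq> par c \<and> par c \<noteq> par b then -1 else 1) * (y $$ (a, c) * x $$ (c, b)))"
proof -
  define h where "h d z = hom_part par d z" for d z
  have hc: "h d x \<in> carrier_mat N N" "h d y \<in> carrier_mat N N" for d
    using x y by (auto simp: h_def hom_part_def)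
  have hi: "h d z $$ (i, j) = (if (par i \<noteq> par j) = d then z $$ (i, j) else 0)"
    if "z \<in> carrier_mat N N" "i < N" "j < N" for d z i j
    using that by (auto simp: h_def hom_part_def)
  have prod: "(u * v) $$ (a, b) = (\<Sum>c<N. u $$ (a, c) * v $$ (c, b))"
    if "u \<in> carrier_mat N N" "v \<in> carrier_mat N N" for u v :: "complex mat"
    using that a b by (simp add: scalar_prod_def atLeast0LessThan)
  have "super_comm par x y $$ (a, b) = (\<Sum>c<N.
      (h False x $$ (a, c) * h False y $$ (c, b) - h False y $$ (a, c) * h False x $$ (c, b))
    + (h False x $$ (a, c) * h True y $$ (c, b) - h True y $$ (a, c) * h False x $$ (c, b))
    + (h True x $$ (a, c) * h False y $$ (c, b) - h False y $$ (a, c) * h True x $$ (c, b))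
    + (h True x $$ (a, c) * h True y $$ (c, b) + h True y $$ (a, c) * h True x $$ (c, b)))"
    unfolding super_comm_def Let_def h_def[symmetric] sum.distrib sum_subtractf
    using a b carrier_matD[OF hc(1)] carrier_matD[OF hc(2)] by (simp add: prod hc del: index_mult_mat(1))
  also have "\<dots> = (\<Sum>c<N. x $$ (a, c) * y $$ (c, b)
       - (if par a \<noteq> par c \<and> par c \<noteq> par b then -1 else 1) * (y $$ (a, c) * x $$ (c, b)))"
  proof (rule sum.cong[OF refl])
    fix c assume "c \<in> {..<N}"
    then have c: "c < N" by simp
    show "(h False x $$ (a, c) * h False y $$ (c, b) - h False y $$ (a, c) * h False x $$ (c, b))
    + (h False x $$ (a, c) * h True y $$ (c, b) - h True y $$ (a, c) * h False x $$ (c, b))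
    + (h True x $$ (a, c) * h False y $$ (c, b) - h False y $$ (a, c) * h True x $$ (c, b))
    + (h True x $$ (a, c) * h True y $$ (c, b) + h True y $$ (a, c) * h True x $$ (c, b))
    = x $$ (a, c) * y $$ (c, b)
       - (if par a \<noteq> par c \<and> par c \<noteq> par b then -1 else 1) * (y $$ (a, c) * x $$ (c, b))"
      unfolding hi[OF x a c] hi[OF y a c] hi[OF x c b] hi[OF y c b]
      by (cases "par a"; cases "par b"; cases "par c"; simp)
  qed
  finally show ?thesis .
qed

lemma super_comm_carrier:
  assumes "x \<in> carrier_mat N N" and "y \<in> carrier_mat N N"
  shows "super_comm par x y \<in> carrier_mat N N"
  using assms by (auto simp: super_comm_def Let_def hom_part_def)

lemma super_comm_even_left:
  assumes z: "z \<in> carrier_mat N N" and y: "y \<in> carrier_mat N N"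
    and even: "\<And>a b. a < N \<Longrightarrow> b < N \<Longrightarrow> par a \<noteq> par b \<Longrightarrow> z $$ (a, b) = 0"
  shows "super_comm par z y = z * y - y * z"
proof (rule eq_matI)
  fix a b assume "a < dim_row (z * y - y * z)" and "b < dim_col (z * y - y * z)"
  then have a: "a < N" and b: "b < N" using z y by auto
  have "super_comm par z y $$ (a, b)
      = (\<Sum>c<N. z $$ (a, c) * y $$ (c, b) - y $$ (a, c) * z $$ (c, b))"
    unfolding super_comm_index[OF z y a b] using even b by (intro sum.cong) auto
  also have "\<dots> = (z * y - y * z) $$ (a, b)"
    using z y a b by (simp add: scalar_prod_def atLeast0LessThan sum_subtractf)
  finally show "super_comm par z y $$ (a, b) = (z * y - y * z) $$ (a, b)" .
qed (use super_comm_carrier[OF z y] z y in auto)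

lemma mat_span_base:
  assumes "S \<subseteq> carrier_mat N N" and "x \<in> S"
  shows "x \<in> mat_span N S"
proof -
  interpret vectorspace class_ring "module_mat TYPE(complex) N N" by (rule matrix_vs)
  show ?thesis
    using span_mem[of S x] assms by (simp add: mat_span_def matrix_vs_simps)
qed

lemma mat_span_closed:
  assumes "S \<subseteq> carrier_mat N N"
  shows mat_span_zero: "0\<^sub>m N N \<in> mat_span N S"
    and mat_span_add: "\<And>x y. x \<in> mat_span N S \<Longrightarrow> y \<in> mat_span N S \<Longrightarrow> x + y \<in> mat_span N S"
    and mat_span_smult: "\<And>c x. x \<in> mat_span N S \<Longrightarrow> c \<cdot>\<^sub>m x \<in> mat_span N S"
proof -
  interpret vectorspace class_ring "module_mat TYPE(complex) N N" by (rule matrix_vs)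
  have "submodule class_ring (span S) (module_mat TYPE(complex) N N)"
    using assms by (intro span_is_submodule) (simp add: matrix_vs_simps)
  then interpret sub: submodule class_ring "span S" "module_mat TYPE(complex) N N" .
  show "0\<^sub>m N N \<in> mat_span N S"
    using sub.zero_closed by (simp add: mat_span_def matrix_vs_simps)
  show "x + y \<in> mat_span N S" if "x \<in> mat_span N S" "y \<in> mat_span N S" for x y
    using sub.m_closed[of x y] that by (simp add: mat_span_def matrix_vs_simps)
  show "c \<cdot>\<^sub>m x \<in> mat_span N S" if "x \<in> mat_span N S" for c x
    using sub.smult_closed[of c x] that by (simp add: mat_span_def matrix_vs_simps)
qed

lemma mat_span_least:
  assumes "S \<subseteq> C" and "C \<subseteq> carrier_mat N N" and "0\<^sub>m N N \<in> C"
    and "\<And>x y. x \<in> C \<Longrightarrow> y \<in> C \<Longrightarrow> x + y \<in> C" and "\<And>c x. x \<in> C \<Longrightarrow> c \<cdot>\<^sub>m x \<in> C"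
  shows "mat_span N S \<subseteq> C"
proof -
  interpret vectorspace class_ring "module_mat TYPE(complex) N N" by (rule matrix_vs)
  have "submodule class_ring C (module_mat TYPE(complex) N N)"
    using assms by unfold_locales (auto simp: matrix_vs_simps)
  then show ?thesis using span_is_subset[OF assms(1)] by (simp add: mat_span_def)
qed

lemma mat_span_sum_entries:
  assumes S: "S \<subseteq> carrier_mat N N" and "finite K" and "\<And>k. k \<in> K \<Longrightarrow> g k \<in> S"
  shows "mat N N (\<lambda>ab. \<Sum>k\<in>K. f k * g k $$ ab) \<in> mat_span N S"
  using assms(2,3)
proof (induction K rule: finite_induct)
  case empty
  then show ?case using mat_span_zero[OF S] by (simp add: zero_mat_def)
next
  case (insert k K)
  have "g k \<in> carrier_mat N N" using insert.prems S by auto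
  then have "mat N N (\<lambda>ab. \<Sum>k\<in>insert k K. f k * g k $$ ab)
      = f k \<cdot>\<^sub>m g k + mat N N (\<lambda>ab. \<Sum>k\<in>K. f k * g k $$ ab)"
    using insert.hyps by (intro eq_matI) auto
  also have "\<dots> \<in> mat_span N S"
    using insert by (intro mat_span_add[OF S] mat_span_smult[OF S] mat_span_base[OF S] insert.IH) auto
  finally show ?case .
qed

section \<open>A nilpotent matrix in a Jordan basis\<close>

text \<open>
  Boxes are located by \<open>(row i, pos i)\<close>, with \<open>pos\<close> counted from 0 at the left end of each row:
  \<open>pos\<close> is the exponent \<open>k\<close> for which \<open>e^k\<close> sends the box to the leftmost one of its row.
\<close>

locale jordan_boxes =
  fixes N :: nat and rows :: "nat set" and len :: "nat \<Rightarrow> nat"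
    and row pos :: "nat \<Rightarrow> nat" and row_parity :: "nat \<Rightarrow> bool"
  assumes boxes: "bij_betw (\<lambda>i. (row i, pos i)) {..<N} (SIGMA j:rows. {..<len j})"
begin

definition par :: "nat \<Rightarrow> bool" where
  "par i = row_parity (row i)"

definition e :: "complex mat" where
  "e = mat N N (\<lambda>(a, b). if row a = row b \<and> pos b = Suc (pos a) then 1 else 0)"

text \<open>The matrix of \<open>\<Sum>\<^sub>k f k e^k\<close>.\<close>

definition poly_in_e :: "(nat \<Rightarrow> complex) \<Rightarrow> complex mat" where
  "poly_in_e f = mat N N (\<lambda>(a, b). if row a = row b \<and> pos a \<le> pos b then f (pos b - pos a) else 0)"

text \<open>
  The \<open>\<complex>[t]\<close>-linear map from row \<open>l\<close> to row \<open>k\<close> that is the quotient map or the inclusion.  The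
  quotient map \<open>\<complex>[t]/(t^\<lambda>\<^sub>l) \<rightarrow> \<complex>[t]/(t^\<lambda>\<^sub>k)\<close> aligns the two rows at their right ends, where the
  generators are, and the inclusion aligns them at their left ends; truncated subtraction covers
  both.
\<close>

definition transfer :: "nat \<Rightarrow> nat \<Rightarrow> complex mat" where
  "transfer k l =
     mat N N (\<lambda>(a, b). if row a = k \<and> row b = l \<and> pos b = pos a + (len l - len k) then 1 else 0)"

abbreviation centralizer :: "complex mat set" where
  "centralizer \<equiv> super_centralizer N par (special_linear N par) e"

lemma e_carrier [simp]: "e \<in> carrier_mat N N"
  and transfer_carrier [simp]: "transfer k l \<in> carrier_mat N N"
  and poly_in_e_carrier [simp]: "poly_in_e f \<in> carrier_mat N N"
  by (simp_all add: e_def transfer_def poly_in_e_def)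

lemma dims [simp]:
  "dim_row e = N" "dim_col e = N" "dim_row (transfer k l) = N" "dim_col (transfer k l) = N"
  by (simp_all add: e_def transfer_def)

lemma row_in_rows: "i < N \<Longrightarrow> row i \<in> rows" and pos_less_len: "i < N \<Longrightarrow> pos i < len (row i)"
  using bij_betwE[OF boxes] by auto

lemma box_exists:
  assumes "j \<in> rows" and "k < len j"
  obtains i where "i < N" "row i = j" "pos i = k"
proof -
  have "(j, k) \<in> (\<lambda>i. (row i, pos i)) ` {..<N}"
    using boxes assms by (auto simp: bij_betw_def)
  then show ?thesis using that by auto
qed

lemma box_unique:
  assumes "i < N" and "i' < N" and "row i = row i'" and "pos i = pos i'"
  shows "i = i'"
  using boxes assms by (auto simp: bij_betw_def inj_on_def)

lemma sum_single_box:
  fixes g :: "nat \<Rightarrow> complex"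
  assumes "c < N" and "\<And>i. i < N \<Longrightarrow> row i \<noteq> row c \<or> pos i \<noteq> pos c \<Longrightarrow> g i = 0"
  shows "(\<Sum>i<N. g i) = g c"
proof -
  have "(\<Sum>i<N. g i) = (\<Sum>i\<in>{c}. g i)"
    using assms box_unique by (intro sum.mono_neutral_right) auto
  then show ?thesis by simp
qed

lemma super_comm_e:
  assumes "y \<in> carrier_mat N N"
  shows "super_comm par e y = e * y - y * e"
  using assms by (intro super_comm_even_left) (auto simp: e_def par_def split: if_splits)

lemma centralizer_iff:
  "y \<in> centralizer \<longleftrightarrow>
    y \<in> carrier_mat N N \<and> supertrace par y = 0 \<and> e * y = y * e"
proof -
  have "e * y - y * e = 0\<^sub>m N N \<longleftrightarrow> e * y = y * e" if y: "y \<in> carrier_mat N N"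
  proof
    assume z: "e * y - y * e = 0\<^sub>m N N"
    show "e * y = y * e"
    proof (rule eq_matI)
      fix a b assume ab: "a < dim_row (y * e)" "b < dim_col (y * e)"
      then have "(e * y - y * e) $$ (a, b) = (e * y) $$ (a, b) - (y * e) $$ (a, b)"
        by (rule index_minus_mat)
      with z ab y show "(e * y) $$ (a, b) = (y * e) $$ (a, b)"
        by (simp del: index_mult_mat(1))
    qed (use y in auto)
  next
    assume h: "e * y = y * e"
    show "e * y - y * e = 0\<^sub>m N N"
      unfolding h by (rule minus_r_inv_mat) (use y in \<open>auto intro: mult_carrier_mat\<close>)
  qed
  then show ?thesis
    by (auto simp: super_centralizer_def special_linear_def super_comm_e)
qed

section \<open>The distinguished maps between rows\<close>

text \<open>
  Both products send a box of row \<open>l\<close> to its image shifted once more to the left.  They agree at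
  the ends of the rows because the image of the transfer map is an initial segment of row \<open>k\<close> of
  length \<open>min \<lambda>\<^sub>k \<lambda>\<^sub>l\<close>.
\<close>

lemma transfer_commutes_e: "e * transfer k l = transfer k l * e"
proof (rule eq_matI)
  fix a b assume "a < dim_row (transfer k l * e)" and "b < dim_col (transfer k l * e)"
  then have a: "a < N" and b: "b < N" by auto
  let ?d = "len l - len k"
  let ?P = "row a = k \<and> row b = l \<and> pos b = Suc (pos a) + ?d"
  have left: "(\<Sum>c<N. e $$ (a, c) * transfer k l $$ (c, b)) = (if ?P then 1 else 0)"
  proof (cases ?P)
    case True
    have "Suc (pos a) < len k" using pos_less_len[OF a] pos_less_len[OF b] True by auto
    then obtain c where c: "c < N" "row c = k" "pos c = Suc (pos a)"
      using row_in_rows[OF a] True box_exists by metis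
    have "(\<Sum>i<N. e $$ (a, i) * transfer k l $$ (i, b)) = e $$ (a, c) * transfer k l $$ (c, b)"
      using c a b True by (intro sum_single_box) (auto simp: e_def)
    then show ?thesis using c a b True by (simp add: e_def transfer_def)
  next
    case False
    then show ?thesis using a b by (auto simp: e_def transfer_def intro!: sum.neutral)
  qed
  have right: "(\<Sum>c<N. transfer k l $$ (a, c) * e $$ (c, b)) = (if ?P then 1 else 0)"
  proof (cases ?P)
    case True
    have "pos a + ?d < len l" using pos_less_len[OF b] True by auto
    then obtain c where c: "c < N" "row c = l" "pos c = pos a + ?d"
      using row_in_rows[OF b] True box_exists by metis
    have "(\<Sum>i<N. transfer k l $$ (a, i) * e $$ (i, b)) = transfer k l $$ (a, c) * e $$ (c, b)"
      using c a b True by (intro sum_single_box) (auto simp: transfer_def)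
    then show ?thesis using c a b True by (simp add: e_def transfer_def)
  next
    case False
    then show ?thesis using a b by (auto simp: e_def transfer_def intro!: sum.neutral)
  qed
  show "(e * transfer k l) $$ (a, b) = (transfer k l * e) $$ (a, b)"
    using a b left right
    by (simp add: scalar_prod_def atLeast0LessThan)
qed auto

lemma transfer_in_centralizer:
  assumes "k \<noteq> l"
  shows "transfer k l \<in> centralizer"
proof -
  have "supertrace par (transfer k l) = 0"
    using assms by (auto simp: supertrace_def transfer_def intro!: sum.neutral)
  then show ?thesis
    by (simp add: centralizer_iff transfer_commutes_e)
qed

section \<open>The centre consists of polynomials in the nilpotent element\<close>

text \<open>
  If \<open>\<lambda>\<^sub>k \<le> \<lambda>\<^sub>i\<close>, every box of row \<open>k\<close> is the image under the transfer map of a box \<open>b\<close> of row \<open>i\<close>,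
  and the coefficient of \<open>[x, y\<^bsub>ki\<^esub>]\<close> at \<open>(a, b)\<close> is the wanted coefficient of \<open>x\<close>.  Otherwise the
  transfer map sends \<open>a\<close> to a box \<open>a'\<close> of row \<open>k\<close>, and the coefficient at \<open>(a', c)\<close> is the wanted one
  up to sign.
\<close>

lemma off_diagonal_block_zero:
  assumes x: "x \<in> super_center N par centralizer"
    and a: "a < N" and c: "c < N" and rows_ne: "row a \<noteq> row c"
  shows "x $$ (a, c) = 0"
proof -
  let ?y = "transfer (row c) (row a)"
  have xc: "x \<in> carrier_mat N N"
    using x by (auto simp: super_center_def centralizer_iff)
  have comm: "super_comm par x ?y = 0\<^sub>m N N"
    using x transfer_in_centralizer[of "row c" "row a"] rows_ne by (auto simp: super_center_def)
  show ?thesis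
  proof (cases "len (row c) \<le> len (row a)")
    case True
    have "pos c + (len (row a) - len (row c)) < len (row a)"
      using pos_less_len[OF c] True by auto
    then obtain b where b: "b < N" "row b = row a" "pos b = pos c + (len (row a) - len (row c))"
      using row_in_rows[OF a] box_exists by metis
    have "super_comm par x ?y $$ (a, b) = (\<Sum>i<N. x $$ (a, i) * ?y $$ (i, b))"
      unfolding super_comm_index[OF xc transfer_carrier a b(1)]
      using a rows_ne by (intro sum.cong) (auto simp: transfer_def)
    also have "\<dots> = x $$ (a, c) * ?y $$ (c, b)"
      using b c by (intro sum_single_box) (auto simp: transfer_def)
    also have "\<dots> = x $$ (a, c)" using b c by (simp add: transfer_def)
    finally show ?thesis using comm a b by simp
  next
    case False
    have "pos a < len (row c)" using pos_less_len[OF a] False by auto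
    then obtain a' where a': "a' < N" "row a' = row c" "pos a' = pos a"
      using row_in_rows[OF c] box_exists by metis
    have "super_comm par x ?y $$ (a', c)
        = (\<Sum>i<N. - ((if par a' \<noteq> par i \<and> par i \<noteq> par c then -1 else 1)
                     * (?y $$ (a', i) * x $$ (i, c))))"
      unfolding super_comm_index[OF xc transfer_carrier a'(1) c]
      using c rows_ne by (intro sum.cong) (auto simp: transfer_def)
    also have "\<dots> = - ((if par a' \<noteq> par a \<and> par a \<noteq> par c then -1 else 1)
                     * (?y $$ (a', a) * x $$ (a, c)))"
      using a a' False by (intro sum_single_box) (auto simp: transfer_def)
    also have "?y $$ (a', a) = 1"
      using a a' False by (simp add: transfer_def)
    finally show ?thesis using comm a' c by (simp split: if_splits)
  qed
qed

text \<open>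
  For \<open>k = row a\<close> different from \<open>l\<close>, this is the coefficient of \<open>x\<^bsub>kk\<^esub> y\<^bsub>kl\<^esub> = y\<^bsub>kl\<^esub> x\<^bsub>ll\<^esub>\<close> at \<open>(a, b)\<close>:
  \<open>a'\<close> and \<open>b\<close> are the boxes of row \<open>l\<close> that the quotient map \<open>y\<^bsub>kl\<^esub>\<close> sends to \<open>a\<close> and \<open>c\<close>.
\<close>

lemma diagonal_block_from_longest:
  assumes x: "x \<in> super_center N par centralizer"
    and l: "l \<in> rows" and longest: "\<And>j. j \<in> rows \<Longrightarrow> len j \<le> len l"
    and a: "a < N" and c: "c < N" and same_row: "row a = row c"
    and a': "a' < N" "row a' = l" "pos a' = pos a + (len l - len (row a))"
    and b: "b < N" "row b = l" "pos b = pos c + (len l - len (row c))"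
  shows "x $$ (a, c) = x $$ (a', b)"
proof (cases "row a = l")
  case True
  then have "a' = a" "b = c" using a a' b c same_row box_unique by auto
  then show ?thesis by simp
next
  case False
  let ?y = "transfer (row a) l"
  have xc: "x \<in> carrier_mat N N"
    using x by (auto simp: super_center_def centralizer_iff)
  have "0 = super_comm par x ?y $$ (a, b)"
    using x transfer_in_centralizer[OF False] a b by (auto simp: super_center_def)
  also have "\<dots> = (\<Sum>i<N. x $$ (a, i) * ?y $$ (i, b)) - (\<Sum>i<N. ?y $$ (a, i) * x $$ (i, b))"
    unfolding super_comm_index[OF xc transfer_carrier a b(1)] sum_subtractf[symmetric]
    using a b by (intro sum.cong) (auto simp: transfer_def par_def)
  also have "(\<Sum>i<N. x $$ (a, i) * ?y $$ (i, b)) = x $$ (a, c) * ?y $$ (c, b)"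
    using b c same_row by (intro sum_single_box) (auto simp: transfer_def)
  also have "(\<Sum>i<N. ?y $$ (a, i) * x $$ (i, b)) = ?y $$ (a, a') * x $$ (a', b)"
    using a a' by (intro sum_single_box) (auto simp: transfer_def)
  finally show ?thesis using a a' b c same_row by (simp add: transfer_def)
qed

lemma e_times_index:
  assumes "x \<in> carrier_mat N N" and "a < N" and "b < N"
    and "a' < N" and "row a' = row a" and "pos a' = Suc (pos a)"
  shows "(e * x) $$ (a, b) = x $$ (a', b)"
proof -
  have "(\<Sum>i<N. e $$ (a, i) * x $$ (i, b)) = e $$ (a, a') * x $$ (a', b)"
    using assms by (intro sum_single_box) (auto simp: e_def)
  then show ?thesis
    using assms
    by (simp add: scalar_prod_def atLeast0LessThan) (simp add: e_def)
qed

lemma times_e_index: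
  assumes "x \<in> carrier_mat N N" and "a < N" and "b < N"
    and "b' < N" and "row b' = row b" and "pos b = Suc (pos b')"
  shows "(x * e) $$ (a, b) = x $$ (a, b')"
proof -
  have "(\<Sum>i<N. x $$ (a, i) * e $$ (i, b)) = x $$ (a, b') * e $$ (b', b)"
    using assms by (intro sum_single_box) (auto simp: e_def)
  then show ?thesis
    using assms
    by (simp add: scalar_prod_def atLeast0LessThan) (simp add: e_def)
qed

lemma times_e_index_left_end:
  assumes "x \<in> carrier_mat N N" and "a < N" and "b < N" and "pos b = 0"
  shows "(x * e) $$ (a, b) = 0"
proof -
  have "(\<Sum>i<N. x $$ (a, i) * e $$ (i, b)) = 0"
    using assms by (intro sum.neutral) (auto simp: e_def)
  then show ?thesis
    using assms by (simp add: scalar_prod_def atLeast0LessThan)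
qed

text \<open>
  Multiplication by \<open>e\<close> on the left reads a block one line further down, and on the right one column
  further to the left, with zero before the first column.  So a matrix commuting with \<open>e\<close> has blocks
  that are constant along diagonals, and a diagonal that starts in the first column below the first
  line is zero.
\<close>

lemma commuting_block_below_diagonal:
  assumes xc: "x \<in> carrier_mat N N" and comm: "e * x = x * e"
    and "a < N" and "b < N" and "pos b < pos a"
  shows "x $$ (a, b) = 0"
  using assms(3-)
proof (induction "pos b" arbitrary: a b)
  case 0
  have "pos a - 1 < len (row a)" using pos_less_len[of a] 0 by auto
  then obtain a0 where a0: "a0 < N" "row a0 = row a" "pos a0 = pos a - 1"
    using row_in_rows[of a] 0 box_exists by metis
  have "x $$ (a, b) = (e * x) $$ (a0, b)"
    using e_times_index[OF xc a0(1), of b a] a0 0 by simp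
  also have "\<dots> = 0" unfolding comm using times_e_index_left_end[OF xc] a0 0 by simp
  finally show ?case .
next
  case (Suc v)
  have "pos a - 1 < len (row a)" using pos_less_len[of a] Suc.prems by auto
  then obtain a0 where a0: "a0 < N" "row a0 = row a" "pos a0 = pos a - 1"
    using row_in_rows[of a] Suc.prems box_exists by metis
  have "v < len (row b)" using pos_less_len[of b] Suc by auto
  then obtain b0 where b0: "b0 < N" "row b0 = row b" "pos b0 = v"
    using row_in_rows[of b] Suc.prems box_exists by metis
  have "x $$ (a, b) = (e * x) $$ (a0, b)"
    using e_times_index[OF xc a0(1), of b a] a0 Suc by simp
  also have "\<dots> = x $$ (a0, b0)"
    unfolding comm using times_e_index[OF xc a0(1), of b b0] b0 Suc by simp
  also have "\<dots> = 0" using Suc(1)[of b0 a0] Suc(2-) a0 b0 by simp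
  finally show ?case .
qed

lemma commuting_block_along_diagonal:
  assumes xc: "x \<in> carrier_mat N N" and comm: "e * x = x * e"
    and z: "z < N" "pos z = 0" and c: "c < N" "row c = j"
    and "a < N" and "b < N" and "row a = row z" and "row b = j" and "pos b = pos c + pos a"
  shows "x $$ (a, b) = x $$ (z, c)"
  using assms(7-)
proof (induction "pos a" arbitrary: a b)
  case 0
  then have "a = z" "b = c" using z c box_unique by auto
  then show ?case by simp
next
  case (Suc u)
  have "u < len (row a)" using pos_less_len[of a] Suc by auto
  then obtain a0 where a0: "a0 < N" "row a0 = row a" "pos a0 = u"
    using row_in_rows[of a] Suc.prems box_exists by metis
  have "pos c + u < len (row b)" using pos_less_len[of b] Suc by auto
  then obtain b0 where b0: "b0 < N" "row b0 = row b" "pos b0 = pos c + u"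
    using row_in_rows[of b] Suc.prems box_exists by metis
  have "x $$ (a, b) = (e * x) $$ (a0, b)"
    using e_times_index[OF xc a0(1), of b a] a0 Suc by simp
  also have "\<dots> = x $$ (a0, b0)"
    unfolding comm using times_e_index[OF xc a0(1), of b b0] b0 Suc by simp
  also have "\<dots> = x $$ (z, c)" using Suc(1)[of a0 b0] Suc(2-) a0 b0 by simp
  finally show ?case .
qed

text \<open>
  The block at a longest row determines the whole of \<open>x\<close>, and being constant along diagonals it is
  determined by its first line, which lists the coefficients of the polynomial.
\<close>

lemma center_is_polynomial:
  assumes x: "x \<in> super_center N par centralizer"
    and l: "l \<in> rows" and longest: "\<And>j. j \<in> rows \<Longrightarrow> len j \<le> len l" and pos_len: "0 < len l"
  obtains f where "x = poly_in_e f"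
proof -
  have xc: "x \<in> carrier_mat N N" and comm: "e * x = x * e"
    using x by (auto simp: super_center_def centralizer_iff)
  have "\<forall>k<len l. \<exists>i. i < N \<and> row i = l \<and> pos i = k"
    using box_exists[OF l] by blast
  then obtain box where "\<forall>k<len l. box k < N \<and> row (box k) = l \<and> pos (box k) = k"
    by metis
  then have box: "box k < N" "row (box k) = l" "pos (box k) = k" if "k < len l" for k
    using that by auto
  define f where "f k = x $$ (box 0, box k)" for k
  have "x = poly_in_e f"
  proof (rule eq_matI)
    fix a b assume "a < dim_row (poly_in_e f)" and "b < dim_col (poly_in_e f)"
    then have a: "a < N" and b: "b < N" by (auto simp: poly_in_e_def)
    show "x $$ (a, b) = poly_in_e f $$ (a, b)"
    proof (cases "row a = row b")
      case False
      then show ?thesis using off_diagonal_block_zero[OF x a b] a b by (simp add: poly_in_e_def)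
    next
      case True
      let ?d = "len l - len (row a)"
      have lt: "pos a + ?d < len l" "pos b + ?d < len l"
        using pos_less_len[OF a] pos_less_len[OF b] longest[OF row_in_rows[OF a]] True by auto
      have "x $$ (a, b) = x $$ (box (pos a + ?d), box (pos b + ?d))"
        using True box(3)[OF lt(1)] box(3)[OF lt(2)]
        by (intro diagonal_block_from_longest[OF x l longest a b True box(1,2)[OF lt(1)] _
              box(1,2)[OF lt(2)]]) simp_all
      also have "\<dots> = (if pos a \<le> pos b then f (pos b - pos a) else 0)"
      proof (cases "pos a \<le> pos b")
        case True
        then have c: "pos b - pos a < len l" using lt by linarith
        have "x $$ (box (pos a + ?d), box (pos b + ?d)) = x $$ (box 0, box (pos b - pos a))"
          using True box(2,3)[OF pos_len] box(2,3)[OF lt(1)] box(2,3)[OF lt(2)] box(2,3)[OF c]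
          by (intro commuting_block_along_diagonal[OF xc comm box(1)[OF pos_len] _ box(1,2)[OF c]
                box(1)[OF lt(1)] box(1)[OF lt(2)]]) simp_all
        then show ?thesis using True by (simp add: f_def)
      next
        case False
        have "x $$ (box (pos a + ?d), box (pos b + ?d)) = 0"
          using False box(3)[OF lt(1)] box(3)[OF lt(2)]
          by (intro commuting_block_below_diagonal[OF xc comm box(1)[OF lt(1)] box(1)[OF lt(2)]])
            simp
        then show ?thesis using False by simp
      qed
      finally show ?thesis using True a b by (simp add: poly_in_e_def)
    qed
  qed (use xc in \<open>auto simp: poly_in_e_def\<close>)
  then show ?thesis by (rule that)
qed

section \<open>The supertraceless polynomials in the nilpotent element\<close>

lemma pow_e_carrier [simp]: "e ^\<^sub>m k \<in> carrier_mat N N"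
  by (simp add: pow_carrier_mat)

lemma pow_e_index:
  assumes "a < N" and "b < N"
  shows "(e ^\<^sub>m k) $$ (a, b) = (if row a = row b \<and> pos b = pos a + k then 1 else 0)"
  using assms(2)
proof (induction k arbitrary: b)
  case 0
  then show ?case using assms(1) box_unique by auto
next
  case (Suc k)
  show ?case
  proof (cases "pos b")
    case 0
    then show ?thesis using times_e_index_left_end[OF pow_e_carrier assms(1) Suc.prems] by simp
  next
    case (Suc v)
    then have "v < len (row b)" using pos_less_len[OF \<open>b < N\<close>] by auto
    then obtain b0 where b0: "b0 < N" "row b0 = row b" "pos b0 = v"
      using row_in_rows[OF \<open>b < N\<close>] box_exists by metis
    then show ?thesis
      using times_e_index[OF pow_e_carrier assms(1) \<open>b < N\<close> b0(1,2)] Suc Suc.IH[OF b0(1)] by simp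
  qed
qed

lemma pow_e_zero: "e ^\<^sub>m 0 = 1\<^sub>m N"
  by simp

lemma pow_e_eq_poly_in_e: "e ^\<^sub>m k = poly_in_e (\<lambda>i. if i = k then 1 else 0)"
proof (rule eq_matI)
  fix a b assume "a < dim_row (poly_in_e (\<lambda>i. if i = k then 1 else 0))"
    and "b < dim_col (poly_in_e (\<lambda>i. if i = k then 1 else 0))"
  then have "a < N" "b < N" by (auto simp: poly_in_e_def)
  then show "(e ^\<^sub>m k) $$ (a, b) = poly_in_e (\<lambda>i. if i = k then 1 else 0) $$ (a, b)"
    by (auto simp: pow_e_index poly_in_e_def)
qed (use carrier_matD[OF pow_e_carrier] in \<open>auto simp: poly_in_e_def\<close>)

lemma poly_in_e_as_sum:
  assumes "finite K" and "\<And>k j. j \<in> rows \<Longrightarrow> k < len j \<Longrightarrow> k \<notin> K \<Longrightarrow> f k = 0"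
  shows "poly_in_e f = mat N N (\<lambda>ab. \<Sum>k\<in>K. f k * (e ^\<^sub>m k) $$ ab)"
proof (rule eq_matI)
  fix a b assume "a < dim_row (mat N N (\<lambda>ab. \<Sum>k\<in>K. f k * (e ^\<^sub>m k) $$ ab))"
    and "b < dim_col (mat N N (\<lambda>ab. \<Sum>k\<in>K. f k * (e ^\<^sub>m k) $$ ab))"
  then have a: "a < N" and b: "b < N" by auto
  let ?P = "row a = row b \<and> pos a \<le> pos b"
  have "(\<Sum>k\<in>K. f k * (e ^\<^sub>m k) $$ (a, b)) = (\<Sum>k\<in>K. if k = pos b - pos a then (if ?P then f k else 0) else 0)"
    using a b by (intro sum.cong) (auto simp: pow_e_index)
  also have "\<dots> = (if ?P then f (pos b - pos a) else 0)"
    using assms(2)[OF row_in_rows[OF b], of "pos b - pos a"] pos_less_len[OF b] assms(1)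
    by (auto simp: less_imp_diff_less)
  finally show "poly_in_e f $$ (a, b) = mat N N (\<lambda>ab. \<Sum>k\<in>K. f k * (e ^\<^sub>m k) $$ ab) $$ (a, b)"
    using a b by (simp add: poly_in_e_def)
qed (auto simp: poly_in_e_def)

definition sdim :: complex where
  "sdim = (\<Sum>i<N. if par i then - 1 else 1)"

lemma supertrace_poly_in_e: "supertrace par (poly_in_e f) = f 0 * sdim"
  by (simp add: supertrace_def poly_in_e_def sdim_def sum_distrib_left mult.commute)

text \<open>The commutant of \<open>y\<close> is a subspace containing all powers of \<open>e\<close>, hence all polynomials in \<open>e\<close>.\<close>

lemma poly_in_e_commutes:
  assumes y: "y \<in> carrier_mat N N" and comm: "e * y = y * e"
  shows "poly_in_e f * y = y * poly_in_e f"
proof -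
  let ?C = "{z \<in> carrier_mat N N. z * y = y * z}"
  have "e ^\<^sub>m k * y = y * e ^\<^sub>m k" for k
  proof (induction k)
    case 0
    then show ?case using y by (simp add: pow_e_zero del: pow_mat.simps)
  next
    case (Suc k)
    have "e ^\<^sub>m Suc k * y = e ^\<^sub>m k * (e * y)"
      using y by (simp add: assoc_mult_mat[OF pow_e_carrier e_carrier y])
    also have "\<dots> = (e ^\<^sub>m k * y) * e"
      unfolding comm by (rule assoc_mult_mat[OF pow_e_carrier y e_carrier, symmetric])
    also have "\<dots> = y * e ^\<^sub>m Suc k"
      unfolding Suc by (simp add: assoc_mult_mat[OF y pow_e_carrier e_carrier])
    finally show ?case .
  qed
  then have "range (\<lambda>k. e ^\<^sub>m k) \<subseteq> ?C" by auto
  then have sub: "mat_span N (range (\<lambda>k. e ^\<^sub>m k)) \<subseteq> ?C"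
  proof (rule mat_span_least)
    show "x + z \<in> ?C" if "x \<in> ?C" "z \<in> ?C" for x z
      using that y by (auto simp: add_mult_distrib_mat[of _ N N] mult_add_distrib_mat[of _ N N])
    show "c \<cdot>\<^sub>m x \<in> ?C" if "x \<in> ?C" for c x
      using that y by (auto simp: mult_smult_distrib[of _ N N] mult_smult_assoc_mat[of _ N N])
  qed (use y in auto)
  have "poly_in_e f = mat N N (\<lambda>ab. \<Sum>k\<in>{..<N}. f k * (e ^\<^sub>m k) $$ ab)"
  proof (rule poly_in_e_as_sum)
    fix k j assume j: "j \<in> rows" "k < len j" "k \<notin> {..<N}"
    have "Pair j ` {..<len j} \<subseteq> (\<lambda>i. (row i, pos i)) ` {..<N}"
      using boxes j by (auto simp: bij_betw_def)
    then have "card (Pair j ` {..<len j}) \<le> card {..<N}" by (rule surj_card_le[rotated]) simp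
    then have "len j \<le> N" by (simp add: card_image inj_on_def)
    then show "f k = 0" using j by simp
  qed simp
  also have "\<dots> \<in> mat_span N (range (\<lambda>k. e ^\<^sub>m k))"
    by (rule mat_span_sum_entries) auto
  finally show ?thesis using sub by auto
qed

lemma center_eq_supertraceless_polynomials:
  assumes l: "l \<in> rows" and longest: "\<And>j. j \<in> rows \<Longrightarrow> len j \<le> len l" and pos_len: "0 < len l"
  shows "super_center N par centralizer = {poly_in_e f | f. f 0 * sdim = 0}"
proof (intro Set.set_eqI iffI)
  fix x assume x: "x \<in> super_center N par centralizer"
  obtain f where f: "x = poly_in_e f" by (rule center_is_polynomial[OF x l longest pos_len])
  have "supertrace par x = 0"
    using x by (auto simp: super_center_def centralizer_iff)
  then show "x \<in> {poly_in_e f | f. f 0 * sdim = 0}" using f by (auto simp: supertrace_poly_in_e)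
next
  fix x assume "x \<in> {poly_in_e f | f. f 0 * sdim = 0}"
  then obtain f where f: "x = poly_in_e f" "f 0 * sdim = 0" by auto
  have "x \<in> centralizer"
    using f poly_in_e_commutes[OF e_carrier refl, of f]
    by (simp add: centralizer_iff supertrace_poly_in_e)
  moreover have "super_comm par x y = 0\<^sub>m N N" if "y \<in> centralizer" for y
  proof -
    have y: "y \<in> carrier_mat N N" "e * y = y * e"
      using that by (auto simp: centralizer_iff)
    have "super_comm par x y = x * y - y * x"
      unfolding f using y(1)
      by (intro super_comm_even_left) (auto simp: poly_in_e_def par_def split: if_splits)
    also have "\<dots> = 0\<^sub>m N N"
      unfolding f poly_in_e_commutes[OF y]
      by (rule minus_r_inv_mat) (use y in \<open>auto intro: mult_carrier_mat\<close>)
    finally show ?thesis .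
  qed
  ultimately show "x \<in> super_center N par centralizer" by (simp add: super_center_def)
qed

text \<open>
  The condition on \<open>k = 0\<close> puts the identity among the generators exactly if it is supertraceless.
\<close>

lemma span_powers_eq_supertraceless_polynomials:
  assumes longest: "\<And>j. j \<in> rows \<Longrightarrow> len j \<le> M" and M: "0 < M"
  shows "mat_span N {e ^\<^sub>m k | k. k < M \<and> (k = 0 \<longrightarrow> sdim = 0)} = {poly_in_e f | f. f 0 * sdim = 0}"
    (is "mat_span N ?S = ?T")
proof
  have add: "poly_in_e f + poly_in_e g = poly_in_e (\<lambda>k. f k + g k)" for f g
    by (rule eq_matI) (auto simp: poly_in_e_def)
  have smult: "c \<cdot>\<^sub>m poly_in_e f = poly_in_e (\<lambda>k. c * f k)" for c f
    by (rule eq_matI) (auto simp: poly_in_e_def)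
  have zero: "0\<^sub>m N N = poly_in_e (\<lambda>k. 0)"
    by (rule eq_matI) (auto simp: poly_in_e_def)
  show "mat_span N ?S \<subseteq> ?T"
  proof (rule mat_span_least)
    show "?S \<subseteq> ?T"
    proof
      fix x assume "x \<in> ?S"
      then obtain k where "x = e ^\<^sub>m k" "k = 0 \<longrightarrow> sdim = 0" by auto
      then show "x \<in> ?T" unfolding pow_e_eq_poly_in_e by fastforce
    qed
    show "?T \<subseteq> carrier_mat N N" by auto
    show "0\<^sub>m N N \<in> ?T" unfolding zero by fastforce
    show "x + y \<in> ?T" if xy: "x \<in> ?T" "y \<in> ?T" for x y
    proof -
      obtain f g where "x = poly_in_e f" "f 0 * sdim = 0" "y = poly_in_e g" "g 0 * sdim = 0"
        using xy by auto
      then show ?thesis using add[of f g] by (auto simp: distrib_right)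
    qed
    show "c \<cdot>\<^sub>m x \<in> ?T" if x: "x \<in> ?T" for c x
    proof -
      obtain f where "x = poly_in_e f" "f 0 * sdim = 0" using x by auto
      then show ?thesis using smult[of c f] by auto
    qed
  qed
  show "?T \<subseteq> mat_span N ?S"
  proof
    fix x assume "x \<in> ?T"
    then obtain f where f: "x = poly_in_e f" "f 0 * sdim = 0" by auto
    let ?K = "{k. k < M \<and> (k = 0 \<longrightarrow> sdim = 0)}"
    have "x = mat N N (\<lambda>ab. \<Sum>k\<in>?K. f k * (e ^\<^sub>m k) $$ ab)"
      unfolding f(1) using f(2) longest
      by (intro poly_in_e_as_sum) (auto dest: less_le_trans)
    also have "\<dots> \<in> mat_span N ?S" by (rule mat_span_sum_entries) auto
    finally show "x \<in> mat_span N ?S" .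
  qed
qed

end

section \<open>The Dynkin pyramid as a Jordan basis\<close>

lemma part_le_part_1:
  assumes "1 \<le> j" and "j \<le> length p + length q"
  shows "part p q j \<le> part p q 1"
proof -
  let ?L = "super_parts p q"
  have "sorted (map (\<lambda>(a, _). - int a) ?L)" by (simp add: super_parts_def)
  then have "map (\<lambda>(a, _). - int a) ?L ! 0 \<le> map (\<lambda>(a, _). - int a) ?L ! (j - 1)"
    using assms by (intro sorted_nth_mono) (auto simp: length_super_parts)
  moreover have "0 < length ?L" and "j - 1 < length ?L"
    using assms by (auto simp: length_super_parts)
  ultimately show ?thesis
    by (simp add: part_def case_prod_beta)
qed

lemma part_positive:
  assumes "is_partition p m" and "is_partition q n" and "1 \<le> j" and "j \<le> length p + length q"
  shows "0 < part p q j"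
proof -
  have "super_parts p q ! (j - 1) \<in> set (super_parts p q)"
    using assms by (intro nth_mem) (simp add: length_super_parts)
  also have "set (super_parts p q) = (\<lambda>a. (a, False)) ` set p \<union> (\<lambda>a. (a, True)) ` set q"
    by (simp add: super_parts_def)
  finally show ?thesis using assms(1,2) by (auto simp: part_def is_partition_def)
qed

text \<open>Column \<open>1 - \<lambda>\<^sub>j + 2k\<close> of row \<open>j\<close> is position \<open>k\<close>.\<close>

definition box_position :: "nat list \<Rightarrow> nat list \<Rightarrow> nat \<times> int \<Rightarrow> nat" where
  "box_position p q b = nat ((snd b - 1 + int (part p q (fst b))) div 2)"

lemma column_of_position:
  assumes "b \<in> pyramid p q"
  shows "snd b = 1 - int (part p q (fst b)) + 2 * int (box_position p q b)"
  using assms by (auto simp: pyramid_def box_position_def)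

lemma bij_betw_pyramid_positions:
  "bij_betw (\<lambda>b. (fst b, box_position p q b)) (pyramid p q)
     (SIGMA j:{1..length p + length q}. {..<part p q j})"
  by (rule bij_betw_byWitness[where f' = "\<lambda>(j, k). (j, 1 - int (part p q j) + 2 * int k)"])
    (auto simp: pyramid_def box_position_def)

lemma jordan_boxes_pyramid:
  assumes "bij_betw bx {..<N} (pyramid p q)"
  shows "jordan_boxes N {1..length p + length q} (part p q)
    (\<lambda>i. fst (bx i)) (\<lambda>i. box_position p q (bx i))"
  using bij_betw_trans[OF assms bij_betw_pyramid_positions]
  by unfold_locales (simp add: o_def)

lemma pyramid_nilpotent_eq_e:
  assumes bx: "bij_betw bx {..<N} (pyramid p q)"
  shows "pyramid_nilpotent N bx = jordan_boxes.e N (\<lambda>i. fst (bx i)) (\<lambda>i. box_position p q (bx i))"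
proof (rule eq_matI)
  interpret jordan_boxes N "{1..length p + length q}" "part p q"
    "\<lambda>i. fst (bx i)" "\<lambda>i. box_position p q (bx i)" "part_parity p q"
    by (rule jordan_boxes_pyramid[OF bx])
  fix a b assume "a < dim_row e" and "b < dim_col e"
  then have a: "a < N" and b: "b < N" by auto
  have "snd (bx a) = 1 - int (part p q (fst (bx a))) + 2 * int (box_position p q (bx a))"
    and "snd (bx b) = 1 - int (part p q (fst (bx b))) + 2 * int (box_position p q (bx b))"
    using bij_betwE[OF bx] a b by (auto intro!: column_of_position)
  then have "bx a = left_neighbour (bx b) \<longleftrightarrow>
      fst (bx a) = fst (bx b) \<and> box_position p q (bx b) = Suc (box_position p q (bx a))"
    by (auto simp: left_neighbour_def prod_eq_iff)
  then show "pyramid_nilpotent N bx $$ (a, b) = e $$ (a, b)"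
    using a b by (simp add: pyramid_nilpotent_def e_def)
qed (simp_all add: pyramid_nilpotent_def jordan_boxes.dims[OF jordan_boxes_pyramid[OF bx]])

lemma superdimension_of_parities:
  fixes P :: "nat \<Rightarrow> bool"
  shows "(\<Sum>i<N. if P i then - 1 else 1 :: complex)
    = of_nat (card {i. i < N \<and> P i = False}) - of_nat (card {i. i < N \<and> P i = True})"
  by (simp add: sum.If_cases Int_def Compl_eq)

theorem theorem13:
  fixes m n :: nat and p q :: "nat list" and bx :: "nat \<Rightarrow> nat \<times> int"
  assumes "1 \<le> m" and "1 \<le> n" and "(m, n) \<noteq> (1, 1)"
    and "is_partition p m" and "is_partition q n"
    and "bij_betw bx {..<m + n} (pyramid p q)"
  shows
    "let N = m + n;
         par = box_parity p q bx;
         \<gg> = special_linear N par;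
         e = pyramid_nilpotent N bx;
         l = part p q 1 - 1
     in super_center N par (super_centralizer N par \<gg> e) =
          (if m = n \<and> n > 1
           then mat_span N (insert (1\<^sub>m N) {e ^\<^sub>m k | k. 1 \<le> k \<and> k \<le> l})
           else mat_span N {e ^\<^sub>m k | k. 1 \<le> k \<and> k \<le> l})"
proof -
  let ?N = "m + n"
  let ?M = "part p q 1"
  interpret J: jordan_boxes ?N "{1..length p + length q}" "part p q"
    "\<lambda>i. fst (bx i)" "\<lambda>i. box_position p q (bx i)" "part_parity p q"
    by (rule jordan_boxes_pyramid[OF assms(6)])
  have par: "J.par = box_parity p q bx"
    by (simp add: fun_eq_iff J.par_def box_parity_def)
  have e: "pyramid_nilpotent ?N bx = J.e" by (rule pyramid_nilpotent_eq_e[OF assms(6)])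
  have "J.sdim = of_nat m - of_nat n"
    unfolding J.sdim_def superdimension_of_parities par
      card_indices_of_parity[OF assms(4-6)] by simp
  then have sdim: "J.sdim = 0 \<longleftrightarrow> m = n" by simp
  have "p \<noteq> []" using assms(1,4) by (auto simp: is_partition_def)
  then have row1: "1 \<in> {1..length p + length q}" by (cases p) auto
  have longest: "part p q j \<le> ?M" if "j \<in> {1..length p + length q}" for j
    using part_le_part_1 that by simp
  have M: "0 < ?M" using part_positive[OF assms(4,5)] row1 by simp
  let ?S = "{J.e ^\<^sub>m k | k. k < ?M \<and> (k = 0 \<longrightarrow> J.sdim = 0)}"
  have center: "super_center ?N J.par J.centralizer = mat_span ?N ?S"
    by (rule trans[OF J.center_eq_supertraceless_polynomials[OF row1 longest M]
          J.span_powers_eq_supertraceless_polynomials[OF longest M, symmetric]])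
  have "{k. k < ?M \<and> (k = 0 \<longrightarrow> J.sdim = 0)}
      = (if m = n then insert 0 {1..?M - 1} else {1..?M - 1})"
    using M by (auto simp: sdim)
  then have "?S = (\<lambda>k. J.e ^\<^sub>m k) ` (if m = n then insert 0 {1..?M - 1} else {1..?M - 1})"
    by blast
  also have "\<dots> = (if m = n \<and> n > 1
      then insert (1\<^sub>m ?N) {J.e ^\<^sub>m k | k. 1 \<le> k \<and> k \<le> ?M - 1}
      else {J.e ^\<^sub>m k | k. 1 \<le> k \<and> k \<le> ?M - 1})"
  proof -
    have "(\<lambda>k. J.e ^\<^sub>m k) ` {1..?M - 1} = {J.e ^\<^sub>m k | k. 1 \<le> k \<and> k \<le> ?M - 1}" by auto
    moreover have "n > 1" if "m = n" using assms(1,3) that by auto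
    ultimately show ?thesis by (simp only: image_insert J.pow_e_zero split: if_split) blast
  qed
  finally show ?thesis
    using center unfolding Let_def e par by (simp only: if_distrib[of "mat_span ?N"])
qed

end
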